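(* Let $k\in[n]$ and suppose $P\subseteq[0,1]^n$ is a convex set such that, for all $x\in P$ and all $I,J,I',J'\subseteq[n]$ with $I\cap J=I'\cap J'=\emptyset$, $I\cup J=I'\cup J'$ and $|I|+|J|=k$, $$x^I_J\in P\iff x^{I'}_{J'}\in P.$$ Then $$\mathrm{SA}_+^k(P)=\mathrm{LS}_0^k(P)=\bigcap_{I\subseteq[n],|I|=k}\{x\in[0,1]^n:x^I_\emptyset\in P\}.$$
   Context: **Notation.** Let $[n]=\{1,\dots,n\}$, $\mathcal F=\{0,1\}^n$. For $x\in[0,1]^n$ and disjoint $I,J\subseteq[n]$, $x^I_J\in[0,1]^n$ is the vector obtained from $x$ by setting all entries indexed by $I$ to $1$ and all entries indexed by $J$ to $0$ (other entries unchanged). For $P\subseteq[0,1]^n$ let $K(P)=\{(\lambda,\lambda x)\in\mathbb R^{n+1}:\lambda\ge 0,\ x\in P\}$. For $S\subseteq[n]$, $t\in\{0,1\}$, let $S|_t=\{x\in\mathcal F: x_i=t\ \forall i\in S\}$ (so $\emptyset|_t=\mathcal F$) and $i|_t=\{i\}|_t$. For $k\ge0$ let $\mathcal A_k=\{S|_1\cap T|_0:S,T\subseteq[n],\ S\cap T=\emptyset,\ |S|+|T|\le k\}$. Matrices have rows and columns indexed by families of subsets of $\mathcal F$; $Ye_\alpha$ is the column of $Y$ indexed by $\alpha$. For a vector $y$ indexed by a family containing $\mathcal F$ and all $i|_1$, $\hat x(y)=(y_{\mathcal F},y_{1|_1},\dots,y_{n|_1})^\top$; for $x\in\mathbb R^n$,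 $\hat x=(1,x)\in\mathbb R^{n+1}$. **The operator $\mathrm{LS}_0$.** $\mathrm{LS}_0(P)=\bigcap_{i\in[n]}\mathrm{conv}(\{x\in P:x_i\in\{0,1\}\})$, and $\mathrm{LS}_0^k(P)$ is the result of applying $\mathrm{LS}_0$ iteratively $k$ times to $P$. **The operator $\mathrm{SA}_+^k$ ($k\ge1$).** For $P\subseteq[0,1]^n$ let $\tilde{\mathrm{SA}}_+^k(P)$ be the set of symmetric positive semidefinite matrices $Y$ indexed by $\mathcal A_k\times\mathcal A_k$ such that: (1) $Y[\mathcal F,\mathcal F]=1$; (2) for every $\alpha\in\mathcal A_k$: $\hat x(Ye_\alpha)\in K(P)$ and $Ye_\alpha\ge0$; (3) for every $S|_1\cap T|_0\in\mathcal A_{k-1}$ and $j\in[n]\setminus(S\cup T)$: $Ye_{S|_1\cap T|_0\cap j|_1}+Ye_{S|_1\cap T|_0\cap j|_0}=Ye_{S|_1\cap T|_0}$; (4) $Y[\alpha,\beta]=0$ for all $\alpha,\beta\in\mathcal A_k$ with $\alpha\cap\beta=\emptyset$; (5) $Y[\alpha_1,\beta_1]=Y[\alpha_2,\beta_2]$ for all $\alpha_1,\alpha_2,\beta_1,\beta_2\in\mathcal A_k$ with $\alpha_1\cap\beta_1=\alpha_2\cap\beta_2$. Then $\mathrm{SA}_+^k(P)=\{x\in\mathbb R^n:\exists Y\in\tilde{\mathrm{SA}}_+^k(P),\ \hat x(Ye_{\mathcal F})=\hat x\}$. *)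

theory Defs
  imports "HOL-Analysis.Analysis"
begin

text \<open>
  The ground set \<open>[n]\<close> is a finite type \<open>'n\<close> with \<open>n = CARD('n)\<close>, the cube \<open>[0,1]\<^sup>n\<close> is
  \<open>cbox 0 1\<close>, and \<open>\<real>\<^sup>n\<^sup>+\<^sup>1\<close> is \<open>real \<times> (real ^ 'n)\<close>, the homogenizing coordinate coming first.
\<close>

definition fix_coords :: "real ^ 'n \<Rightarrow> 'n set \<Rightarrow> 'n set \<Rightarrow> real ^ 'n" where
  "fix_coords x I J = (\<chi> i. if i \<in> I then 1 else if i \<in> J then 0 else x $ i)"

definition homogenization :: "(real ^ 'n) set \<Rightarrow> (real \<times> (real ^ 'n)) set" where
  "homogenization P = {(r, r *\<^sub>R x) |r x. 0 \<le> r \<and> x \<in> P}"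

definition LS0 :: "(real ^ 'n) set \<Rightarrow> (real ^ 'n) set" where
  "LS0 P = (\<Inter>i. convex hull {x \<in> P. x $ i \<in> {0, 1}})"

definition binary_points :: "(real ^ 'n) set" where
  "binary_points = {x. \<forall>i. x $ i \<in> {0, 1}}"

definition face :: "'n set \<Rightarrow> real \<Rightarrow> (real ^ 'n) set" where
  "face S t = {x \<in> binary_points. \<forall>i\<in>S. x $ i = t}"

definition face_family :: "nat \<Rightarrow> (real ^ 'n) set set" where
  "face_family k = {face S 1 \<inter> face T 0 |S T. S \<inter> T = {} \<and> card S + card T \<le> k}"

text \<open>
  A vector indexed by a family of subsets of \<open>binary_points\<close> is a total function, and so is a
  matrix, row index first. Only the entries indexed by the family matter, and every condition
  below is relativized to it.
\<close>

definition column ::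
  "((real ^ 'n) set \<Rightarrow> (real ^ 'n) set \<Rightarrow> real) \<Rightarrow> (real ^ 'n) set \<Rightarrow> (real ^ 'n) set \<Rightarrow> real" where
  "column Y \<alpha> = (\<lambda>\<beta>. Y \<beta> \<alpha>)"

definition xhat :: "((real ^ 'n) set \<Rightarrow> real) \<Rightarrow> real \<times> (real ^ 'n)" where
  "xhat y = (y binary_points, \<chi> i. y (face {i} 1))"

definition sym_psd_on :: "'a set \<Rightarrow> ('a \<Rightarrow> 'a \<Rightarrow> real) \<Rightarrow> bool" where
  "sym_psd_on A Y \<longleftrightarrow>
     (\<forall>\<alpha>\<in>A. \<forall>\<beta>\<in>A. Y \<alpha> \<beta> = Y \<beta> \<alpha>) \<and>
     (\<forall>v :: 'a \<Rightarrow> real. 0 \<le> (\<Sum>\<alpha>\<in>A. \<Sum>\<beta>\<in>A. v \<alpha> * Y \<alpha> \<beta> * v \<beta>))"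

definition SA_plus_lift ::
  "nat \<Rightarrow> (real ^ 'n) set \<Rightarrow> ((real ^ 'n) set \<Rightarrow> (real ^ 'n) set \<Rightarrow> real) set" where
  "SA_plus_lift k P = {Y.
     sym_psd_on (face_family k) Y \<and>
     Y binary_points binary_points = 1 \<and>
     (\<forall>\<alpha>\<in>face_family k.
        xhat (column Y \<alpha>) \<in> homogenization P \<and> (\<forall>\<beta>\<in>face_family k. 0 \<le> column Y \<alpha> \<beta>)) \<and>
     (\<forall>S T j. face S 1 \<inter> face T 0 \<in> face_family (k - 1) \<and> j \<notin> S \<union> T \<longrightarrow>
        (\<forall>\<beta>\<in>face_family k.
           column Y (face S 1 \<inter> face T 0 \<inter> face {j} 1) \<beta> +
           column Y (face S 1 \<inter> face T 0 \<inter> face {j} 0) \<beta> =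
           column Y (face S 1 \<inter> face T 0) \<beta>)) \<and>
     (\<forall>\<alpha>\<in>face_family k. \<forall>\<beta>\<in>face_family k. \<alpha> \<inter> \<beta> = {} \<longrightarrow> Y \<alpha> \<beta> = 0) \<and>
     (\<forall>\<alpha>1\<in>face_family k. \<forall>\<alpha>2\<in>face_family k. \<forall>\<beta>1\<in>face_family k. \<forall>\<beta>2\<in>face_family k.
        \<alpha>1 \<inter> \<beta>1 = \<alpha>2 \<inter> \<beta>2 \<longrightarrow> Y \<alpha>1 \<beta>1 = Y \<alpha>2 \<beta>2)}"

text \<open>
  Meant for \<open>k \<ge> 1\<close> only: for \<open>k = 0\<close> the sets \<open>face {i} 1\<close> read off by \<open>xhat\<close> need not
  belong to \<open>face_family k\<close>.
\<close>

definition SA_plus :: "nat \<Rightarrow> (real ^ 'n) set \<Rightarrow> (real ^ 'n) set" where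
  "SA_plus k P = {x. \<exists>Y\<in>SA_plus_lift k P. xhat (column Y binary_points) = (1, x)}"

end

theory Submission
  imports Defs
begin

text \<open>
  Write \<open>R\<close> for the intersection on the right. A point of \<open>P\<close> that is integral on a \<open>k\<close>-set \<open>I\<close>
  may be rounded up on \<open>I\<close> without leaving \<open>P\<close>; since \<open>x \<mapsto> x\<^sup>I\<close> is affine, so may every
  convex combination of such points, and both operators decompose their points in that way. Hence
  both are contained in \<open>R\<close>. Conversely, for \<open>x \<in> R\<close> all points obtained by rounding \<open>x\<close> on
  \<open>k\<close> coordinates are in \<open>P\<close>. Splitting one coordinate at a time puts \<open>x\<close> into \<open>LS0\<^sup>k P\<close>, and the
  matrix \<open>Y \<alpha> \<beta> = \<mu> (\<alpha> \<inter> \<beta>)\<close>, where \<open>\<mu>\<close> is the product measure on the binary points with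
  marginals \<open>x\<close>, certifies \<open>x \<in> SA_plus k P\<close>.
\<close>

section \<open>Fixing coordinates\<close>

lemma fix_coords_empty [simp]: "fix_coords x {} {} = x"
  by (simp add: fix_coords_def vec_eq_iff)

lemma fix_coords_nth:
  "fix_coords x I J $ i = (if i \<in> I then 1 else if i \<in> J then 0 else x $ i)"
  by (simp add: fix_coords_def)

lemma fix_coords_fix_coords:
  assumes "I \<union> J \<subseteq> I' \<union> J'"
  shows "fix_coords (fix_coords x I J) I' J' = fix_coords x I' J'"
  using assms by (auto simp: fix_coords_nth vec_eq_iff)

text \<open>The two points on the right differ only in coordinate \<open>i\<close>, which averages
  to \<open>x $ i\<close>. Both downward inductions on the number of fixed coordinates rest on this
  splitting.\<close>

lemma fix_coords_split:
  assumes "i \<notin> S \<union> T"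
  shows "fix_coords x S T =
    (x $ i) *\<^sub>R fix_coords x (insert i S) T + (1 - x $ i) *\<^sub>R fix_coords x S (insert i T)"
  using assms by (auto simp: fix_coords_nth vec_eq_iff algebra_simps)

lemma fix_coords_convex_combination:
  assumes "u + v = 1"
  shows "fix_coords (u *\<^sub>R x + v *\<^sub>R y) I J = u *\<^sub>R fix_coords x I J + v *\<^sub>R fix_coords y I J"
  using assms by (auto simp: fix_coords_nth vec_eq_iff)

lemma convex_fix_coords_preimage:
  assumes "convex P"
  shows "convex {x. fix_coords x I J \<in> P}"
  using assms by (auto simp: convex_def fix_coords_convex_combination)

text \<open>0 and 1 are extreme in the unit interval, so a proper convex combination is binary on
  \<open>L\<close> only if both end points are; the rest is that fixing coordinates is affine.
  Phrasing integrality as a premise inside the set lets \<open>hull_minimal\<close> apply although a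
  hull contains points that are not binary on \<open>L\<close>.\<close>

lemma convex_fix_coords_if_binary:
  fixes P :: "(real ^ 'n) set"
  assumes "convex P"
  shows "convex {z \<in> cbox 0 1. (\<forall>i\<in>L. z $ i \<in> {0, 1}) \<longrightarrow> fix_coords z I J \<in> P}"
    (is "convex ?Z")
proof (rule convexI)
  fix x y :: "real ^ 'n" and u v :: real
  assume x: "x \<in> ?Z" and y: "y \<in> ?Z" and uv: "0 \<le> u" "0 \<le> v" "u + v = 1"
  let ?z = "u *\<^sub>R x + v *\<^sub>R y"
  have box: "?z \<in> cbox 0 1"
    using x y uv convex_box(1)[of 0 "1 :: real ^ 'n"] by (simp add: convex_def)
  show "?z \<in> ?Z"
  \<comment> \<open>The extremality argument needs both weights positive; otherwise the combination
    is one of its end points.\<close>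
  proof (cases "u = 0 \<or> v = 0")
    case True
    then show ?thesis using x y uv by auto
  next
    case False
    with uv have pos: "0 < u" "0 < v" by auto
    have "fix_coords ?z I J \<in> P" if bin: "\<forall>i\<in>L. ?z $ i \<in> {0, 1}"
    proof -
      have "x $ i \<in> {0, 1} \<and> y $ i \<in> {0, 1}" if "i \<in> L" for i
      proof -
        have b: "0 \<le> x $ i" "x $ i \<le> 1" "0 \<le> y $ i" "y $ i \<le> 1"
          using x y by (auto simp: mem_box_cart)
        \<comment> \<open>The value 1 is turned into a vanishing combination of the complements, so
          in either case a sum of nonnegative terms is zero.\<close>
        from bin that consider "u * x $ i + v * y $ i = 0"
          | "u * (1 - x $ i) + v * (1 - y $ i) = 0"
          using uv by (fastforce simp: algebra_simps)
        then show ?thesis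
        proof cases
          case 1
          then show ?thesis
            using b pos by (simp add: add_nonneg_eq_0_iff)
        next
          case 2
          then show ?thesis
            using b pos by (simp add: add_nonneg_eq_0_iff)
        qed
      qed
      then have "fix_coords x I J \<in> P" "fix_coords y I J \<in> P"
        using x y by auto
      then show ?thesis
        using assms uv by (simp add: fix_coords_convex_combination convexD)
    qed
    with box show ?thesis by blast
  qed
qed

text \<open>Descends from exactly \<open>k\<close> fixed coordinates to fewer, as
  \<open>face_family k\<close> contains faces of every codimension up to \<open>k\<close>. As long
  as fewer than \<open>k\<close> coordinates are fixed, \<open>k \<le> CARD('n)\<close> leaves a
  free one to split on.\<close>

lemma fix_coords_mem_mono:
  assumes "convex P" "x \<in> cbox 0 1" "S \<inter> T = {}" "card S + card T \<le> k" "k \<le> CARD('n)"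
    and full: "\<And>S T. S \<inter> T = {} \<Longrightarrow> card S + card T = k \<Longrightarrow> fix_coords x S T \<in> P"
  shows "fix_coords (x :: real ^ 'n) S T \<in> P"
  using assms(3,4)
proof (induction "k - (card S + card T)" arbitrary: S T)
  case 0
  then show ?case by (simp add: full)
next
  case (Suc d)
  have "card (S \<union> T) < CARD('n)"
    using Suc.hyps(2) assms(5) card_Un_le[of S T] by linarith
  then obtain i where i: "i \<notin> S \<union> T"
    by (metis UNIV_eq_I less_irrefl)
  then have "fix_coords x (insert i S) T \<in> P" "fix_coords x S (insert i T) \<in> P"
    using Suc by (auto intro!: Suc.hyps(1))
  then show ?case
    unfolding fix_coords_split[OF i]
    using assms(1,2) by (auto intro!: convexD simp: mem_box_cart)
qed

section \<open>The operator LS0\<close>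

lemma LS0_subset_cbox:
  assumes "P \<subseteq> cbox 0 1"
  shows "LS0 P \<subseteq> cbox 0 1"
proof -
  have "convex hull {x \<in> P. x $ i \<in> {0, 1}} \<subseteq> cbox 0 1" for i
    using assms by (intro hull_minimal) (auto simp: convex_box)
  then show ?thesis by (auto simp: LS0_def)
qed

lemma LS0_funpow_subset_cbox:
  assumes "P \<subseteq> cbox 0 1"
  shows "(LS0 ^^ j) P \<subseteq> cbox 0 1"
  using assms by (induction j) (simp_all add: LS0_subset_cbox)

text \<open>Each round of \<open>LS0\<close> is undone by choosing a new coordinate of
  \<open>I\<close> and passing to generators of the hull that are binary there. So \<open>L\<close>
  gains an element whenever \<open>j\<close> drops, and at \<open>j = 0\<close> it has become all of
  \<open>I\<close>, where \<open>round\<close> applies.\<close>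

lemma LS0_funpow_imp_fix_coords:
  assumes P: "P \<subseteq> cbox 0 1" "convex P"
    and round: "\<And>x I. x \<in> P \<Longrightarrow> \<forall>i\<in>I. x $ i \<in> {0, 1} \<Longrightarrow> card I = k \<Longrightarrow> fix_coords x I {} \<in> P"
    and "x \<in> (LS0 ^^ j) P" "L \<subseteq> I" "card I = k" "card L + j = k" "\<forall>i\<in>L. x $ i \<in> {0, 1}"
  shows "fix_coords x I {} \<in> P"
  using assms(4-8)
proof (induction j arbitrary: x L)
  case 0
  then have "L = I" by (simp add: card_subset_eq)
  with 0 show ?case by (auto intro: round)
next
  case (Suc j)
  obtain i where i: "i \<in> I" "i \<notin> L"
    using Suc.prems by (metis add_eq_self_zero nat.distinct(1) subsetI subset_antisym)
  let ?Z = "{z \<in> cbox 0 1. (\<forall>i\<in>L. z $ i \<in> {0, 1}) \<longrightarrow> fix_coords z I {} \<in> P}"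
  have "{y \<in> (LS0 ^^ j) P. y $ i \<in> {0, 1}} \<subseteq> ?Z"
  proof
    fix y assume y: "y \<in> {y \<in> (LS0 ^^ j) P. y $ i \<in> {0, 1}}"
    have "fix_coords y I {} \<in> P" if "\<forall>i\<in>L. y $ i \<in> {0, 1}"
      using Suc.prems y i that by (intro Suc.IH[of _ "insert i L"]) auto
    then show "y \<in> ?Z"
      using y LS0_funpow_subset_cbox[OF P(1)] by blast
  qed
  then have "convex hull {y \<in> (LS0 ^^ j) P. y $ i \<in> {0, 1}} \<subseteq> ?Z"
    by (intro hull_minimal convex_fix_coords_if_binary P)
  \<comment> \<open>\<open>LS0\<close> intersects over all coordinates, so the factor belonging to
    the chosen \<open>i\<close> is available.\<close>
  moreover have "x \<in> convex hull {y \<in> (LS0 ^^ j) P. y $ i \<in> {0, 1}}"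
    using Suc.prems(1) LS0_def[of "(LS0 ^^ j) P"] by auto
  ultimately show ?case
    using Suc.prems(5) by blast
qed

text \<open>Every coordinate fixed pays for one round less of \<open>LS0\<close>, starting from the
  points with \<open>k\<close> fixed coordinates, which lie in \<open>P\<close>.\<close>

lemma fix_coords_in_LS0_funpow:
  assumes x: "x \<in> cbox 0 1" and k: "k \<le> CARD('n)"
    and full: "\<And>S T. S \<inter> T = {} \<Longrightarrow> card S + card T = k \<Longrightarrow> fix_coords x S T \<in> P"
    and "S \<inter> T = {}" "card S + card T + j = k"
  shows "fix_coords (x :: real ^ 'n) S T \<in> (LS0 ^^ j) P"
  using assms(4,5)
proof (induction j arbitrary: S T)
  case 0
  then show ?case by (simp add: full)
next
  case (Suc j)
  have "fix_coords x S T \<in> convex hull {y \<in> (LS0 ^^ j) P. y $ i \<in> {0, 1}}" for i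
  proof -
    have "card (S \<union> T) < CARD('n)"
      using Suc.prems k card_Un_le[of S T] by linarith
    \<comment> \<open>If \<open>i\<close> is free, it is the coordinate to split on; if it is
      already fixed, any free coordinate will do. Either way both halves are binary at
      \<open>i\<close>.\<close>
    then obtain i' where i': "i' \<notin> S \<union> T" "i \<in> S \<union> T \<or> i' = i"
      by (metis UNIV_eq_I less_irrefl)
    let ?H = "{y \<in> (LS0 ^^ j) P. y $ i \<in> {0, 1}}"
    have "fix_coords x (insert i' S) T \<in> ?H" "fix_coords x S (insert i' T) \<in> ?H"
      using Suc.prems i' by (auto intro!: Suc.IH simp: fix_coords_nth)
    then show ?thesis
      unfolding fix_coords_split[OF i'(1)]
      using x by (intro convexD[OF convex_convex_hull] hull_inc) (auto simp: mem_box_cart)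
  qed
  then show ?case using LS0_def[of "(LS0 ^^ j) P"] by simp
qed

section \<open>Faces of the binary cube\<close>

lemma face_Int_face_empty [simp]: "face {} t \<inter> face {} u = binary_points"
  by (auto simp: face_def)

lemma face_insert: "face (insert j S) t = face S t \<inter> face {j} t"
  by (auto simp: face_def)

lemma face_mem_face_family:
  assumes "S \<inter> T = {}" "card S + card T \<le> k"
  shows "face S 1 \<inter> face T 0 \<in> face_family k"
  using assms by (auto simp: face_family_def)

lemma binary_points_mem_face_family [simp]: "binary_points \<in> face_family k"
  using face_mem_face_family[of "{}" "{}" k] by simp

lemma face_singleton_mem_face_family:
  assumes "1 \<le> k"
  shows "face {i} 1 \<in> face_family k"
proof -
  have "face {i} 1 \<inter> face {} 0 = face {i} 1" by (auto simp: face_def)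
  then show ?thesis using face_mem_face_family[of "{i}" "{}" k] assms by simp
qed

lemma face_family_subset: "\<alpha> \<in> face_family k \<Longrightarrow> \<alpha> \<subseteq> binary_points"
  by (auto simp: face_family_def face_def)

text \<open>The product form makes the exchange of sum and product over a face available.\<close>

lemma face_Int_eq_PiE:
  assumes "S \<inter> T = {}"
  shows "face S 1 \<inter> face T 0 =
    vec_lambda ` (\<Pi>\<^sub>E i\<in>UNIV. if i \<in> S then {1} else if i \<in> T then {0} else {0, 1})"
    (is "_ = vec_lambda ` ?B")
proof (intro equalityI subsetI)
  fix z assume "z \<in> face S 1 \<inter> face T 0"
  then have "vec_nth z \<in> ?B" by (auto simp: face_def binary_points_def)
  then have "vec_lambda (vec_nth z) \<in> vec_lambda ` ?B" by (rule imageI)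
  then show "z \<in> vec_lambda ` ?B" by simp
next
  fix z assume "z \<in> vec_lambda ` ?B"
  then obtain g where g: "g \<in> ?B" and z: "z = vec_lambda g" by blast
  have g_i: "g i \<in> (if i \<in> S then {1} else if i \<in> T then {0} else {0, 1})" for i
    using g by (rule PiE_mem) simp
  have "g i \<in> {0, 1}" "i \<in> S \<Longrightarrow> g i = 1" "i \<in> T \<Longrightarrow> g i = 0" for i
    using g_i[of i] assms by (auto split: if_splits)
  then show "z \<in> face S 1 \<inter> face T 0"
    by (simp add: z face_def binary_points_def)
qed

lemma finite_binary_points [simp]: "finite (binary_points :: (real ^ 'n) set)"
proof -
  have eq: "binary_points = vec_lambda ` (\<Pi>\<^sub>E i\<in>(UNIV :: 'n set). {0, 1 :: real})"
    using face_Int_eq_PiE[of "{} :: 'n set" "{}"] by simp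
  have "finite (\<Pi>\<^sub>E i\<in>(UNIV :: 'n set). {0, 1 :: real})"
    by (intro finite_PiE) auto
  then show ?thesis
    unfolding eq by (rule finite_imageI)
qed

section \<open>The product measure\<close>

text \<open>The probability of \<open>z\<close> when the coordinates are independent and coordinate
  \<open>i\<close> equals 1 with probability \<open>x $ i\<close>. Values other than 1 are treated
  like 0, so this reading is for binary \<open>z\<close>.\<close>

definition point_weight :: "real ^ 'n \<Rightarrow> real ^ 'n \<Rightarrow> real" where
  "point_weight x z = (\<Prod>i\<in>UNIV. if z $ i = 1 then x $ i else 1 - x $ i)"

definition product_matrix :: "real ^ 'n \<Rightarrow> (real ^ 'n) set \<Rightarrow> (real ^ 'n) set \<Rightarrow> real" where
  "product_matrix x \<alpha> \<beta> = sum (point_weight x) (\<alpha> \<inter> \<beta>)"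

lemma point_weight_nonneg:
  assumes "x \<in> cbox 0 1"
  shows "0 \<le> point_weight x z"
  using assms by (auto simp: point_weight_def mem_box_cart intro!: prod_nonneg)

text \<open>The sum factorizes over the coordinates, and a free coordinate contributes
  \<open>x $ i + (1 - x $ i) = 1\<close>.\<close>

lemma sum_point_weight_face:
  assumes "S \<inter> T = {}"
  shows "sum (point_weight x) (face S 1 \<inter> face T 0) =
    (\<Prod>i\<in>UNIV. if i \<in> S then x $ i else if i \<in> T then 1 - x $ i else 1)"
proof -
  let ?B = "\<lambda>i. if i \<in> S then {1} else if i \<in> T then {0} else {0, 1 :: real}"
  let ?f = "\<lambda>i t. if t = 1 then x $ i else 1 - x $ i"
  have "inj_on vec_lambda (PiE UNIV ?B)"
    by (auto simp: inj_on_def vec_lambda_inject)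
  then have "sum (point_weight x) (face S 1 \<inter> face T 0) =
      (\<Sum>g\<in>PiE UNIV ?B. \<Prod>i\<in>UNIV. ?f i (g i))"
    by (simp add: face_Int_eq_PiE[OF assms] sum.reindex point_weight_def)
  also have "\<dots> = (\<Prod>i\<in>UNIV. \<Sum>t\<in>?B i. ?f i t)"
    by (subst prod_sum_PiE) auto
  also have "\<dots> = (\<Prod>i\<in>UNIV. if i \<in> S then x $ i else if i \<in> T then 1 - x $ i else 1)"
    by (intro prod.cong) auto
  finally show ?thesis .
qed

text \<open>By independence, conditioning on a face changes the marginals only at its fixed
  coordinates, so the conditional mean is \<open>fix_coords x S T\<close>. The product form also
  covers faces of measure zero.\<close>

lemma sum_point_weight_face_Int:
  assumes "S \<inter> T = {}"
  shows "sum (point_weight x) (face {i} 1 \<inter> (face S 1 \<inter> face T 0)) =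
    sum (point_weight x) (face S 1 \<inter> face T 0) * fix_coords x S T $ i"
proof -
  consider "i \<in> S" | "i \<in> T" "i \<notin> S" | "i \<notin> S" "i \<notin> T" by blast
  then show ?thesis
  proof cases
    case 1
    then have "face {i} 1 \<inter> (face S 1 \<inter> face T 0) = face S 1 \<inter> face T 0"
      by (auto simp: face_def)
    with 1 show ?thesis by (simp add: fix_coords_nth)
  next
    case 2
    then have "face {i} 1 \<inter> (face S 1 \<inter> face T 0) = {}"
      by (auto simp: face_def)
    with 2 show ?thesis by (simp add: fix_coords_nth)
  next
    case 3
    have "face {i} 1 \<inter> (face S 1 \<inter> face T 0) = face (insert i S) 1 \<inter> face T 0"
      using face_insert[of i S 1] by blast
    moreover have "insert i S \<inter> T = {}" using assms 3 by blast
    moreover have "(\<Prod>l\<in>UNIV. if l \<in> insert i S then x $ l else if l \<in> T then 1 - x $ l else 1) =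
        (\<Prod>l\<in>UNIV. if l \<in> S then x $ l else if l \<in> T then 1 - x $ l else 1) * x $ i"
    proof -
      have "(\<Prod>l\<in>UNIV - {i}. if l \<in> insert i S then x $ l else if l \<in> T then 1 - x $ l else 1) =
          (\<Prod>l\<in>UNIV - {i}. if l \<in> S then x $ l else if l \<in> T then 1 - x $ l else 1)"
        by (intro prod.cong) auto
      then show ?thesis
        using 3 by (simp add: prod.remove[of UNIV i])
    qed
    ultimately show ?thesis
      using assms 3 by (simp add: sum_point_weight_face fix_coords_nth)
  qed
qed

text \<open>Displays the matrix as a weighted sum of rank-one matrices, one for each binary
  point.\<close>

lemma product_matrix_eq_sum:
  assumes "\<alpha> \<subseteq> binary_points"
  shows "product_matrix x \<alpha> \<beta> =
    (\<Sum>z\<in>binary_points. point_weight x z * of_bool (z \<in> \<alpha>) * of_bool (z \<in> \<beta>))"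
proof -
  have "product_matrix x \<alpha> \<beta> = (\<Sum>z\<in>\<alpha> \<inter> \<beta>. point_weight x z * of_bool (z \<in> \<alpha>) * of_bool (z \<in> \<beta>))"
    by (simp add: product_matrix_def)
  also have "\<dots> = (\<Sum>z\<in>binary_points. point_weight x z * of_bool (z \<in> \<alpha>) * of_bool (z \<in> \<beta>))"
    using assms by (intro sum.mono_neutral_left) auto
  finally show ?thesis .
qed

lemma sym_psd_on_product_matrix:
  assumes "x \<in> cbox 0 1" "\<And>\<alpha>. \<alpha> \<in> A \<Longrightarrow> \<alpha> \<subseteq> binary_points"
  shows "sym_psd_on A (product_matrix x)"
  unfolding sym_psd_on_def
proof (intro conjI ballI allI)
  show "product_matrix x \<alpha> \<beta> = product_matrix x \<beta> \<alpha>" for \<alpha> \<beta>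
    by (simp add: product_matrix_def Int_commute)
next
  fix v :: "(real ^ 'a) set \<Rightarrow> real"
  have "(\<Sum>\<alpha>\<in>A. \<Sum>\<beta>\<in>A. v \<alpha> * product_matrix x \<alpha> \<beta> * v \<beta>) =
      (\<Sum>\<alpha>\<in>A. \<Sum>\<beta>\<in>A. \<Sum>z\<in>binary_points.
        point_weight x z * ((v \<alpha> * of_bool (z \<in> \<alpha>)) * (v \<beta> * of_bool (z \<in> \<beta>))))"
    using assms(2)
    by (intro sum.cong) (simp_all add: product_matrix_eq_sum sum_distrib_left sum_distrib_right mult_ac)
  also have "\<dots> = (\<Sum>\<alpha>\<in>A. \<Sum>z\<in>binary_points. \<Sum>\<beta>\<in>A.
        point_weight x z * ((v \<alpha> * of_bool (z \<in> \<alpha>)) * (v \<beta> * of_bool (z \<in> \<beta>))))"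
    by (intro sum.cong refl sum.swap)
  also have "\<dots> = (\<Sum>z\<in>binary_points. \<Sum>\<alpha>\<in>A. \<Sum>\<beta>\<in>A.
        point_weight x z * ((v \<alpha> * of_bool (z \<in> \<alpha>)) * (v \<beta> * of_bool (z \<in> \<beta>))))"
    by (rule sum.swap)
  \<comment> \<open>With the sum over \<open>z\<close> outermost, the quadratic form is a
    nonnegatively weighted sum of squares.\<close>
  also have "\<dots> = (\<Sum>z\<in>binary_points. point_weight x z * (\<Sum>\<alpha>\<in>A. v \<alpha> * of_bool (z \<in> \<alpha>))\<^sup>2)"
    by (simp add: power2_eq_square sum_product flip: sum_distrib_left)
  also have "\<dots> \<ge> 0"
    using point_weight_nonneg[OF assms(1)] by (intro sum_nonneg mult_nonneg_nonneg) auto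
  finally show "0 \<le> (\<Sum>\<alpha>\<in>A. \<Sum>\<beta>\<in>A. v \<alpha> * product_matrix x \<alpha> \<beta> * v \<beta>)" .
qed

lemma xhat_product_matrix:
  assumes "S \<inter> T = {}"
  shows "xhat (column (product_matrix x) (face S 1 \<inter> face T 0)) =
    (let m = sum (point_weight x) (face S 1 \<inter> face T 0) in (m, m *\<^sub>R fix_coords x S T))"
proof -
  have "binary_points \<inter> (face S 1 \<inter> face T 0) = face S 1 \<inter> face T 0"
    by (auto simp: face_def)
  then show ?thesis
    using sum_point_weight_face_Int[OF assms, of x]
    by (simp add: xhat_def column_def product_matrix_def Let_def vec_eq_iff)
qed

lemma product_matrix_mem_SA_plus_lift:
  assumes x: "x \<in> cbox 0 1"
    and P: "\<And>S T. S \<inter> T = {} \<Longrightarrow> card S + card T \<le> k \<Longrightarrow> fix_coords x S T \<in> P"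
  shows "product_matrix x \<in> SA_plus_lift k P"
  unfolding SA_plus_lift_def mem_Collect_eq
proof (intro conjI)
  show "sym_psd_on (face_family k) (product_matrix x)"
    using x face_family_subset by (rule sym_psd_on_product_matrix)
  show "product_matrix x binary_points binary_points = 1"
    using sum_point_weight_face[of "{}" "{}" x] by (simp add: product_matrix_def)
  show "\<forall>\<alpha>\<in>face_family k. xhat (column (product_matrix x) \<alpha>) \<in> homogenization P \<and>
      (\<forall>\<beta>\<in>face_family k. 0 \<le> column (product_matrix x) \<alpha> \<beta>)"
  proof (intro ballI conjI)
    fix \<alpha> :: "(real ^ 'a) set" assume "\<alpha> \<in> face_family k"
    then obtain S T where ST: "\<alpha> = face S 1 \<inter> face T 0" "S \<inter> T = {}" "card S + card T \<le> k"
      by (auto simp: face_family_def)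
    then show "xhat (column (product_matrix x) \<alpha>) \<in> homogenization P"
      using P[OF ST(2,3)] sum_nonneg[of \<alpha> "point_weight x"] point_weight_nonneg[OF x]
      unfolding xhat_product_matrix[OF ST(2)] ST(1) Let_def homogenization_def by blast
  qed (auto simp: column_def product_matrix_def intro!: sum_nonneg point_weight_nonneg x)
  show "\<forall>S T j. face S 1 \<inter> face T 0 \<in> face_family (k - 1) \<and> j \<notin> S \<union> T \<longrightarrow>
      (\<forall>\<beta>\<in>face_family k.
         column (product_matrix x) (face S 1 \<inter> face T 0 \<inter> face {j} 1) \<beta> +
         column (product_matrix x) (face S 1 \<inter> face T 0 \<inter> face {j} 0) \<beta> =
         column (product_matrix x) (face S 1 \<inter> face T 0) \<beta>)"
  proof (intro allI impI ballI)
    fix S T :: "'a set" and j and \<beta> :: "(real ^ 'a) set"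
    assume "\<beta> \<in> face_family k"
    then have "\<beta> \<subseteq> binary_points" by (rule face_family_subset)
    \<comment> \<open>The splitting condition is additivity of the measure: a binary point has value
      0 or 1 at \<open>j\<close>, never both.\<close>
    then have "\<beta> \<inter> (face S 1 \<inter> face T 0) =
        \<beta> \<inter> (face S 1 \<inter> face T 0 \<inter> face {j} 1) \<union> \<beta> \<inter> (face S 1 \<inter> face T 0 \<inter> face {j} 0)"
      by (auto simp: face_def binary_points_def)
    moreover have "finite \<beta>"
      using \<open>\<beta> \<subseteq> binary_points\<close> finite_binary_points by (rule finite_subset)
    moreover have "\<beta> \<inter> (face S 1 \<inter> face T 0 \<inter> face {j} 1) \<inter>
        (\<beta> \<inter> (face S 1 \<inter> face T 0 \<inter> face {j} 0)) = {}"
      by (auto simp: face_def)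
    ultimately show "column (product_matrix x) (face S 1 \<inter> face T 0 \<inter> face {j} 1) \<beta> +
         column (product_matrix x) (face S 1 \<inter> face T 0 \<inter> face {j} 0) \<beta> =
         column (product_matrix x) (face S 1 \<inter> face T 0) \<beta>"
      unfolding column_def product_matrix_def by (metis finite_Int sum.union_disjoint)
  qed
  show "\<forall>\<alpha>\<in>face_family k. \<forall>\<beta>\<in>face_family k. \<alpha> \<inter> \<beta> = {} \<longrightarrow> product_matrix x \<alpha> \<beta> = 0"
    by (simp add: product_matrix_def)
  show "\<forall>\<alpha>1\<in>face_family k. \<forall>\<alpha>2\<in>face_family k. \<forall>\<beta>1\<in>face_family k. \<forall>\<beta>2\<in>face_family k.
      \<alpha>1 \<inter> \<beta>1 = \<alpha>2 \<inter> \<beta>2 \<longrightarrow> product_matrix x \<alpha>1 \<beta>1 = product_matrix x \<alpha>2 \<beta>2"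
    unfolding product_matrix_def by (intro ballI impI) (erule arg_cong)
qed

lemma mem_SA_plus_if_fix_coords:
  assumes x: "x \<in> cbox 0 1"
    and P: "\<And>S T. S \<inter> T = {} \<Longrightarrow> card S + card T \<le> k \<Longrightarrow> fix_coords x S T \<in> P"
  shows "x \<in> SA_plus k P"
proof -
  have "xhat (column (product_matrix x) binary_points) = (1, x)"
    using xhat_product_matrix[of "{}" "{}" x] sum_point_weight_face[of "{}" "{}" x]
    by (simp add: Let_def)
  then show ?thesis
    using product_matrix_mem_SA_plus_lift[OF x P] by (auto simp: SA_plus_def)
qed

section \<open>Decomposing a column of a lift\<close>

lemma sum_Pow_insert:
  assumes "finite I" "j \<notin> I"
  shows "(\<Sum>S\<in>Pow (insert j I). f S) = (\<Sum>S\<in>Pow I. f S) + (\<Sum>S\<in>Pow I. f (insert j S))"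
proof -
  have "Pow I \<inter> insert j ` Pow I = {}" "inj_on (insert j) (Pow I)"
    using assms(2) by (auto simp: inj_on_def)
  then show ?thesis
    using assms(1) by (simp add: Pow_insert sum.union_disjoint sum.reindex)
qed

lemma SA_plus_liftD:
  assumes "Y \<in> SA_plus_lift k P"
  shows SA_plus_lift_homogenization:
      "\<alpha> \<in> face_family k \<Longrightarrow> xhat (column Y \<alpha>) \<in> homogenization P"
    and SA_plus_lift_add:
      "face S 1 \<inter> face T 0 \<in> face_family (k - 1) \<Longrightarrow> j \<notin> S \<union> T \<Longrightarrow> \<beta> \<in> face_family k \<Longrightarrow>
        Y \<beta> (face S 1 \<inter> face T 0 \<inter> face {j} 1) + Y \<beta> (face S 1 \<inter> face T 0 \<inter> face {j} 0) =
        Y \<beta> (face S 1 \<inter> face T 0)"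
    and SA_plus_lift_disjoint:
      "\<alpha> \<in> face_family k \<Longrightarrow> \<beta> \<in> face_family k \<Longrightarrow> \<alpha> \<inter> \<beta> = {} \<Longrightarrow> Y \<alpha> \<beta> = 0"
    and SA_plus_lift_Int_cong:
      "\<alpha> \<in> face_family k \<Longrightarrow> \<alpha>' \<in> face_family k \<Longrightarrow> \<beta> \<in> face_family k \<Longrightarrow> \<beta>' \<in> face_family k \<Longrightarrow>
        \<alpha> \<inter> \<beta> = \<alpha>' \<inter> \<beta>' \<Longrightarrow> Y \<alpha> \<beta> = Y \<alpha>' \<beta>'"
proof -
  note lift = assms[unfolded SA_plus_lift_def mem_Collect_eq, THEN conjunct2, THEN conjunct2]
  show "\<alpha> \<in> face_family k \<Longrightarrow> xhat (column Y \<alpha>) \<in> homogenization P"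
    by (rule lift[THEN conjunct1, rule_format, THEN conjunct1])
  show "face S 1 \<inter> face T 0 \<in> face_family (k - 1) \<Longrightarrow> j \<notin> S \<union> T \<Longrightarrow> \<beta> \<in> face_family k \<Longrightarrow>
      Y \<beta> (face S 1 \<inter> face T 0 \<inter> face {j} 1) + Y \<beta> (face S 1 \<inter> face T 0 \<inter> face {j} 0) =
      Y \<beta> (face S 1 \<inter> face T 0)"
    by (rule lift[THEN conjunct2, THEN conjunct1, unfolded column_def, rule_format, OF conjI])
  show "\<alpha> \<in> face_family k \<Longrightarrow> \<beta> \<in> face_family k \<Longrightarrow> \<alpha> \<inter> \<beta> = {} \<Longrightarrow> Y \<alpha> \<beta> = 0"
    by (rule lift[THEN conjunct2, THEN conjunct2, THEN conjunct1, rule_format])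
  show "\<alpha> \<in> face_family k \<Longrightarrow> \<alpha>' \<in> face_family k \<Longrightarrow> \<beta> \<in> face_family k \<Longrightarrow> \<beta>' \<in> face_family k \<Longrightarrow>
      \<alpha> \<inter> \<beta> = \<alpha>' \<inter> \<beta>' \<Longrightarrow> Y \<alpha> \<beta> = Y \<alpha>' \<beta>'"
    by (rule lift[THEN conjunct2, THEN conjunct2, THEN conjunct2, rule_format])
qed

text \<open>The splitting condition is iterated over \<open>I\<close>, breaking the column of
  \<open>binary_points\<close> up by the 0/1 pattern on \<open>I\<close>; \<open>S\<close> is the
  set of ones. It is stated entrywise, in row \<open>\<beta>\<close>.\<close>

lemma SA_plus_lift_split:
  assumes Y: "Y \<in> SA_plus_lift k P" and "card I \<le> k" and \<beta>: "\<beta> \<in> face_family k"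
  shows "(\<Sum>S\<in>Pow I. Y \<beta> (face S 1 \<inter> face (I - S) 0)) = Y \<beta> binary_points"
  using finite[of I] assms(2)
proof (induction I rule: finite_induct)
  case empty
  then show ?case by simp
next
  case (insert j I)
  have "Y \<beta> (face S 1 \<inter> face (insert j I - S) 0) +
      Y \<beta> (face (insert j S) 1 \<inter> face (insert j I - insert j S) 0) =
      Y \<beta> (face S 1 \<inter> face (I - S) 0)" if "S \<in> Pow I" for S
  proof -
    have "card S + card (I - S) = card I"
      using that insert.hyps(1) by (simp add: card_Diff_subset finite_subset card_mono)
    \<comment> \<open>\<open>I\<close> is one element smaller than \<open>insert j I\<close>, whose
      size is at most \<open>k\<close>; this supplies the level \<open>k - 1\<close>.\<close>
    then have "face S 1 \<inter> face (I - S) 0 \<in> face_family (k - 1)"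
      using insert.hyps insert.prems by (intro face_mem_face_family) auto
    moreover have "j \<notin> S \<union> (I - S)" using insert.hyps that by auto
    ultimately have "Y \<beta> (face S 1 \<inter> face (I - S) 0 \<inter> face {j} 1) +
        Y \<beta> (face S 1 \<inter> face (I - S) 0 \<inter> face {j} 0) = Y \<beta> (face S 1 \<inter> face (I - S) 0)"
      by (rule SA_plus_lift_add[OF Y _ _ \<beta>])
    moreover have "face S 1 \<inter> face (insert j I - S) 0 = face S 1 \<inter> face (I - S) 0 \<inter> face {j} 0"
      "face (insert j S) 1 \<inter> face (insert j I - insert j S) 0 =
        face S 1 \<inter> face (I - S) 0 \<inter> face {j} 1"
      using insert.hyps(2) that by (auto simp: face_def)
    ultimately show ?thesis by simp
  qed
  then have "(\<Sum>S\<in>Pow (insert j I). Y \<beta> (face S 1 \<inter> face (insert j I - S) 0)) =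
      (\<Sum>S\<in>Pow I. Y \<beta> (face S 1 \<inter> face (I - S) 0))"
    using insert.hyps by (simp add: sum_Pow_insert flip: sum.distrib)
  then show ?case
    using insert by simp
qed

text \<open>A column is a weight times a point \<open>y\<close> of \<open>P\<close>, and the
  consistency conditions on \<open>Y\<close> make \<open>y\<close> binary on the coordinates fixed
  by \<open>\<alpha>\<close>. At weight zero the column says nothing about \<open>y\<close>, hence
  the guard in the last conclusion.\<close>

lemma SA_plus_lift_column:
  assumes Y: "Y \<in> SA_plus_lift k P" and k: "1 \<le> k"
    and ST: "S \<inter> T = {}" "card S + card T \<le> k"
    and \<alpha>: "\<alpha> = face S 1 \<inter> face T 0"
  obtains y where "y \<in> P" "0 \<le> Y binary_points \<alpha>"
    "\<And>i. Y (face {i} 1) \<alpha> = Y binary_points \<alpha> * y $ i"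
    "Y binary_points \<alpha> \<noteq> 0 \<Longrightarrow> \<forall>i\<in>S \<union> T. y $ i \<in> {0, 1}"
proof -
  have \<alpha>_mem: "\<alpha> \<in> face_family k"
    using ST by (simp add: \<alpha> face_mem_face_family)
  then have "xhat (column Y \<alpha>) \<in> homogenization P"
    by (rule SA_plus_lift_homogenization[OF Y])
  then obtain y where y: "y \<in> P" "0 \<le> Y binary_points \<alpha>"
    "\<And>i. Y (face {i} 1) \<alpha> = Y binary_points \<alpha> * y $ i"
    by (auto simp: homogenization_def xhat_def column_def vec_eq_iff)
  have "y $ i \<in> {0, 1}" if nz: "Y binary_points \<alpha> \<noteq> 0" and "i \<in> S \<union> T" for i
  proof (cases "i \<in> S")
    case True
    \<comment> \<open>Equal intersections force equal entries, so weight times \<open>y $ i\<close>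
      equals the weight and \<open>y $ i = 1\<close>.\<close>
    then have "face {i} 1 \<inter> \<alpha> = binary_points \<inter> \<alpha>"
      by (auto simp: \<alpha> face_def)
    then have "Y (face {i} 1) \<alpha> = Y binary_points \<alpha>"
      by (intro SA_plus_lift_Int_cong[OF Y] \<alpha>_mem face_singleton_mem_face_family k
          binary_points_mem_face_family)
    then show ?thesis using y(3)[of i] nz by simp
  next
    case False
    \<comment> \<open>Here \<open>i\<close> lies in \<open>T\<close>; disjointness makes the entry
      vanish and \<open>y $ i = 0\<close>.\<close>
    then have "face {i} 1 \<inter> \<alpha> = {}"
      using that by (auto simp: \<alpha> face_def)
    then have "Y (face {i} 1) \<alpha> = 0"
      by (intro SA_plus_lift_disjoint[OF Y] \<alpha>_mem face_singleton_mem_face_family k)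
    then show ?thesis using y(3)[of i] nz by simp
  qed
  with y show ?thesis using that by blast
qed

text \<open>The columns of the faces fixing exactly \<open>I\<close> exhibit \<open>x\<close> as a
  convex combination of points of \<open>P\<close> that are binary on \<open>I\<close>. Each of
  these may be rounded up, and the points with that property form a convex set.\<close>

lemma SA_plus_imp_fix_coords:
  assumes P: "convex P" and k: "1 \<le> k"
    and round: "\<And>x I. x \<in> P \<Longrightarrow> \<forall>i\<in>I. x $ i \<in> {0, 1} \<Longrightarrow> card I = k \<Longrightarrow> fix_coords x I {} \<in> P"
    and x: "x \<in> SA_plus k P" and I: "card I = k"
  shows "fix_coords x I {} \<in> P"
proof -
  obtain Y where Y: "Y \<in> SA_plus_lift k P" and "xhat (column Y binary_points) = (1, x)"
    using x by (auto simp: SA_plus_def)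
  then have Yx: "Y binary_points binary_points = 1" "\<And>i. Y (face {i} 1) binary_points = x $ i"
    by (auto simp: xhat_def column_def)
  define \<alpha> where "\<alpha> S = face S 1 \<inter> face (I - S) 0" for S
  define w where "w S = Y binary_points (\<alpha> S)" for S
  have "\<exists>y. y \<in> P \<and> 0 \<le> w S \<and> (\<forall>i. Y (face {i} 1) (\<alpha> S) = w S * y $ i) \<and>
      (w S \<noteq> 0 \<longrightarrow> (\<forall>i\<in>I. y $ i \<in> {0, 1}))" if "S \<in> Pow I" for S
  proof -
    have "S \<inter> (I - S) = {}" by blast
    moreover have "card S + card (I - S) \<le> k"
      using that I card_mono[of I S] by (simp add: card_Diff_subset)
    ultimately obtain y where "y \<in> P" "0 \<le> w S" "\<And>i. Y (face {i} 1) (\<alpha> S) = w S * y $ i"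
      "w S \<noteq> 0 \<Longrightarrow> \<forall>i\<in>S \<union> (I - S). y $ i \<in> {0, 1}"
      using SA_plus_lift_column[OF Y k _ _ \<alpha>_def] unfolding w_def by metis
    then show ?thesis using that by blast
  qed
  then obtain y where y: "\<And>S. S \<in> Pow I \<Longrightarrow> y S \<in> P" "\<And>S. S \<in> Pow I \<Longrightarrow> 0 \<le> w S"
    "\<And>S i. S \<in> Pow I \<Longrightarrow> Y (face {i} 1) (\<alpha> S) = w S * y S $ i"
    "\<And>S i. S \<in> Pow I \<Longrightarrow> w S \<noteq> 0 \<Longrightarrow> i \<in> I \<Longrightarrow> y S $ i \<in> {0, 1}"
    by metis
  \<comment> \<open>Row \<open>binary_points\<close> of the split column gives the total weight; the
    rows \<open>face {i} 1\<close> then give the coordinates of \<open>x\<close>.\<close>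
  have sum_w: "(\<Sum>S\<in>Pow I. w S) = 1"
    using SA_plus_lift_split[OF Y, of I binary_points] I Yx(1) by (simp add: w_def \<alpha>_def)
  have "(\<Sum>S\<in>Pow I. w S * y S $ i) = x $ i" for i
    using SA_plus_lift_split[OF Y _ face_singleton_mem_face_family[OF k], of I i] I Yx(2)
    by (simp add: y(3) flip: \<alpha>_def)
  then have sum_wy: "(\<Sum>S\<in>Pow I. w S *\<^sub>R y S) = x"
    by (simp add: vec_eq_iff)
  \<comment> \<open>Points of weight zero need not be binary on \<open>I\<close>, so they are
    dropped before \<open>round\<close> is applied.\<close>
  define \<Omega> where "\<Omega> = {S \<in> Pow I. w S \<noteq> 0}"
  have "(\<Sum>S\<in>\<Omega>. w S *\<^sub>R y S) \<in> {z. fix_coords z I {} \<in> P}"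
  proof (rule convex_sum)
    show "(\<Sum>S\<in>\<Omega>. w S) = 1"
      unfolding sum_w[symmetric] \<Omega>_def by (intro sum.mono_neutral_left) auto
    show "y S \<in> {z. fix_coords z I {} \<in> P}" if "S \<in> \<Omega>" for S
      using that y(1,4)[of S] I by (auto simp: \<Omega>_def intro!: round)
  qed (auto simp: \<Omega>_def y(2) intro: convex_fix_coords_preimage P)
  moreover have "(\<Sum>S\<in>\<Omega>. w S *\<^sub>R y S) = x"
    unfolding sum_wy[symmetric] \<Omega>_def by (intro sum.mono_neutral_left) auto
  ultimately show ?thesis by simp
qed

lemma SA_plus_subset: "SA_plus k P \<subseteq> P"
proof
  fix x assume "x \<in> SA_plus k P"
  then obtain Y where "Y \<in> SA_plus_lift k P" "xhat (column Y binary_points) = (1, x)"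
    by (auto simp: SA_plus_def)
  then have "(1, x) \<in> homogenization P"
    using SA_plus_lift_homogenization binary_points_mem_face_family by metis
  then show "x \<in> P" by (auto simp: homogenization_def)
qed

theorem corollary16:
  fixes P :: "(real ^ 'n) set" and k :: nat
  assumes "k \<in> {1..CARD('n)}"
    and "P \<subseteq> cbox 0 1"
    and "convex P"
    and "\<And>x I J I' J'. x \<in> P \<Longrightarrow> I \<inter> J = {} \<Longrightarrow> I' \<inter> J' = {} \<Longrightarrow>
           I \<union> J = I' \<union> J' \<Longrightarrow> card I + card J = k \<Longrightarrow>
           fix_coords x I J \<in> P \<longleftrightarrow> fix_coords x I' J' \<in> P"
  shows "SA_plus k P = (LS0 ^^ k) P \<and>
         (LS0 ^^ k) P = (\<Inter>I\<in>{I. card I = k}. {x \<in> cbox 0 1. fix_coords x I {} \<in> P})"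
proof -
  let ?R = "\<Inter>I\<in>{I. card I = k}. {x \<in> cbox 0 1. fix_coords x I {} \<in> P}"
  have k: "1 \<le> k" "k \<le> CARD('n)" using assms(1) by auto
  have round: "fix_coords x I {} \<in> P"
    if "x \<in> P" "\<forall>i\<in>I. x $ i \<in> {0, 1}" "card I = k" for x I
  proof -
    \<comment> \<open>Fixing \<open>x\<close> to the values it already has on \<open>I\<close>
      changes nothing, so the hypothesis compares \<open>x\<close> itself with its rounding
      up.\<close>
    let ?S = "{i \<in> I. x $ i = 1}"
    have "fix_coords x ?S (I - ?S) = x"
      using that(2) by (auto simp: fix_coords_nth vec_eq_iff)
    moreover have "card ?S + card (I - ?S) = k"
      using that(3) card_mono[of I ?S] by (simp add: card_Diff_subset)
    moreover have "?S \<union> (I - ?S) = I \<union> {}" "?S \<inter> (I - ?S) = {}" by blast+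
    ultimately show ?thesis
      using assms(4)[OF that(1), of ?S "I - ?S" I "{}"] that(1) by (metis inf_bot_right)
  qed
  \<comment> \<open>The cube constraint sits inside the intersection, so \<open>?R\<close> lies in
    the cube only because some \<open>I\<close> of size \<open>k\<close> exists.\<close>
  obtain I0 :: "'n set" where I0: "card I0 = k"
    using k(2) obtain_subset_with_card_n[of k "UNIV :: 'n set"] by auto
  have R_D: "x \<in> cbox 0 1" "card I = k \<Longrightarrow> fix_coords x I {} \<in> P" if "x \<in> ?R" for x I
    using that I0 by auto
  have R_I: "x \<in> ?R" if "x \<in> cbox 0 1" "\<And>I. card I = k \<Longrightarrow> fix_coords x I {} \<in> P" for x
    using that by auto
  have R_full: "fix_coords x S T \<in> P"
    if x: "x \<in> ?R" and ST: "S \<inter> T = {}" "card S + card T = k" for x S T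
  proof -
    \<comment> \<open>The hypothesis speaks only of points of \<open>P\<close>, and \<open>x\<close>
      is not yet known to be one. It is applied to \<open>?y\<close>, whose altered coordinates are
      overwritten again.\<close>
    let ?y = "fix_coords x (S \<union> T) {}"
    have card: "card (S \<union> T) = k"
      using card_Un_disjoint[of S T] ST by simp
    then have "?y \<in> P" by (rule R_D(2)[OF x])
    moreover from this have "fix_coords ?y (S \<union> T) {} \<in> P \<longleftrightarrow> fix_coords ?y S T \<in> P"
      by (rule assms(4)) (use card ST in auto)
    ultimately show ?thesis by (simp add: fix_coords_fix_coords)
  qed
  have "SA_plus k P \<subseteq> ?R"
  proof (intro subsetI R_I)
    fix x assume x: "x \<in> SA_plus k P"
    then show "x \<in> cbox 0 1" using SA_plus_subset assms(2) by blast
    show "fix_coords x I {} \<in> P" if "card I = k" for I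
      using assms(3) k(1) round x that by (rule SA_plus_imp_fix_coords)
  qed
  moreover have "?R \<subseteq> SA_plus k P"
  proof
    fix x assume x: "x \<in> ?R"
    show "x \<in> SA_plus k P"
    proof (rule mem_SA_plus_if_fix_coords)
      show "x \<in> cbox 0 1" by (rule R_D(1)[OF x])
      show "fix_coords x S T \<in> P" if "S \<inter> T = {}" "card S + card T \<le> k" for S T
        using assms(3) R_D(1)[OF x] that k(2) R_full[OF x] by (rule fix_coords_mem_mono)
    qed
  qed
  moreover have "(LS0 ^^ k) P \<subseteq> ?R"
  proof (intro subsetI R_I)
    fix x assume x: "x \<in> (LS0 ^^ k) P"
    then show "x \<in> cbox 0 1" using LS0_funpow_subset_cbox[OF assms(2)] by blast
    show "fix_coords x I {} \<in> P" if "card I = k" for I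
      using assms(2,3) round x empty_subsetI that by (rule LS0_funpow_imp_fix_coords) simp_all
  qed
  moreover have "?R \<subseteq> (LS0 ^^ k) P"
  proof
    fix x assume x: "x \<in> ?R"
    have "fix_coords x {} {} \<in> (LS0 ^^ k) P"
      using R_D(1)[OF x] k(2) R_full[OF x] by (rule fix_coords_in_LS0_funpow) simp_all
    then show "x \<in> (LS0 ^^ k) P" by simp
  qed
  ultimately have "SA_plus k P = ?R" "(LS0 ^^ k) P = ?R"
    by (simp_all only: subset_antisym)
  then show ?thesis by (simp only: simp_thms)
qed

end
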